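(* For every integer $n\ge 2$, the semigroup $\mathcal{SS}'_n$ is right abundant.
   Context: Let $[n]=\{1,2,\dots,n\}$ with its usual order. $\mathcal{P}_n$ is the semigroup of all partial transformations of $[n]$ (maps whose domain and image are subsets of $[n]$, including the empty map), composed from left to right: $x(\alpha\beta)=(x\alpha)\beta$. A partial map $\alpha$ is isotone if $x\le y$ implies $x\alpha\le y\alpha$ for all $x,y\in\mathrm{Dom}\,\alpha$, and order-decreasing if $x\alpha\le x$ for all $x\in\mathrm{Dom}\,\alpha$. $\mathcal{LS}_n$ is the monoid of all isotone order-decreasing $\alpha\in\mathcal{P}_n$, and $\mathcal{SS}'_n=\{\alpha\in\mathcal{LS}_n: 1\notin \mathrm{Dom}\,\alpha\}$, a subsemigroup of $\mathcal{LS}_n$. For a semigroup $S$, $S^1$ is $S$ with an identity adjoined if necessary, and $\mathcal{R}^*$ is the relation on $S$ given by $(a,b)\in\mathcal{R}^*$ if and only if for all $x,y\in S^1$: $xa=ya\iff xb=yb$. $S$ is right abundant if every $\mathcal{R}^*$-class of $S$ contains an idempotent. *)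

theory Defs
  imports Main
begin

section \<open>Semigroups on a carrier and the relation R*\<close>

definition semigroup_on :: "'a set \<Rightarrow> ('a \<Rightarrow> 'a \<Rightarrow> 'a) \<Rightarrow> bool" where
  "semigroup_on S mul \<longleftrightarrow>
     (\<forall>x\<in>S. \<forall>y\<in>S. mul x y \<in> S) \<and>
     (\<forall>x\<in>S. \<forall>y\<in>S. \<forall>z\<in>S. mul (mul x y) z = mul x (mul y z))"

definition has_identity :: "'a set \<Rightarrow> ('a \<Rightarrow> 'a \<Rightarrow> 'a) \<Rightarrow> bool" where
  "has_identity S mul \<longleftrightarrow> (\<exists>e\<in>S. \<forall>x\<in>S. mul e x = x \<and> mul x e = x)"

text \<open>The monoid \<open>S\<^sup>1\<close> lives on the option type: \<open>Some s\<close> stands for \<open>s \<in> S\<close>, and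
  \<open>None\<close> is the adjoined identity, which is present only when \<open>S\<close> has no identity.\<close>

definition adjoin_one :: "'a set \<Rightarrow> ('a \<Rightarrow> 'a \<Rightarrow> 'a) \<Rightarrow> 'a option set" where
  "adjoin_one S mul = (if has_identity S mul then Some ` S else insert None (Some ` S))"

fun mul_one :: "('a \<Rightarrow> 'a \<Rightarrow> 'a) \<Rightarrow> 'a option \<Rightarrow> 'a option \<Rightarrow> 'a option" where
  "mul_one mul None y = y"
| "mul_one mul (Some x) None = Some x"
| "mul_one mul (Some x) (Some y) = Some (mul x y)"

definition R_star :: "'a set \<Rightarrow> ('a \<Rightarrow> 'a \<Rightarrow> 'a) \<Rightarrow> ('a \<times> 'a) set" where
  "R_star S mul = {(a, b). a \<in> S \<and> b \<in> S \<and>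
     (\<forall>x\<in>adjoin_one S mul. \<forall>y\<in>adjoin_one S mul.
        mul_one mul x (Some a) = mul_one mul y (Some a) \<longleftrightarrow>
        mul_one mul x (Some b) = mul_one mul y (Some b))}"

lemma equiv_R_star: "equiv S (R_star S mul)"
  by (rule equivI) (auto simp: R_star_def refl_on_def sym_def trans_def)

definition right_abundant :: "'a set \<Rightarrow> ('a \<Rightarrow> 'a \<Rightarrow> 'a) \<Rightarrow> bool" where
  "right_abundant S mul \<longleftrightarrow> (\<forall>C \<in> S // R_star S mul. \<exists>e\<in>C. mul e e = e)"

section \<open>Partial transformations of \<open>{1..n}\<close>\<close>

definition partial_transformations :: "nat \<Rightarrow> (nat \<rightharpoonup> nat) set" where
  "partial_transformations n = {\<alpha>. dom \<alpha> \<subseteq> {1..n} \<and> ran \<alpha> \<subseteq> {1..n}}"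

text \<open>Left-to-right composition: \<open>\<alpha>\<close> is applied first.\<close>

definition pt_mult :: "(nat \<rightharpoonup> nat) \<Rightarrow> (nat \<rightharpoonup> nat) \<Rightarrow> (nat \<rightharpoonup> nat)" where
  "pt_mult \<alpha> \<beta> = \<beta> \<circ>\<^sub>m \<alpha>"

definition isotone :: "(nat \<rightharpoonup> nat) \<Rightarrow> bool" where
  "isotone \<alpha> \<longleftrightarrow> (\<forall>x\<in>dom \<alpha>. \<forall>y\<in>dom \<alpha>. x \<le> y \<longrightarrow> the (\<alpha> x) \<le> the (\<alpha> y))"

definition order_decreasing :: "(nat \<rightharpoonup> nat) \<Rightarrow> bool" where
  "order_decreasing \<alpha> \<longleftrightarrow> (\<forall>x\<in>dom \<alpha>. the (\<alpha> x) \<le> x)"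

definition LS :: "nat \<Rightarrow> (nat \<rightharpoonup> nat) set" where
  "LS n = {\<alpha> \<in> partial_transformations n. isotone \<alpha> \<and> order_decreasing \<alpha>}"

definition SS' :: "nat \<Rightarrow> (nat \<rightharpoonup> nat) set" where
  "SS' n = {\<alpha> \<in> LS n. 1 \<notin> dom \<alpha>}"

lemma pt_mult_assoc: "pt_mult (pt_mult \<alpha> \<beta>) \<gamma> = pt_mult \<alpha> (pt_mult \<beta> \<gamma>)"
  by (auto simp: pt_mult_def map_comp_def fun_eq_iff split: option.splits)

lemma pt_mult_LS:
  assumes "\<alpha> \<in> LS n" "\<beta> \<in> LS n"
  shows "pt_mult \<alpha> \<beta> \<in> LS n"
proof -
  have sub: "dom (pt_mult \<alpha> \<beta>) \<subseteq> dom \<alpha>" "ran (pt_mult \<alpha> \<beta>) \<subseteq> ran \<beta>"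
    by (auto simp: pt_mult_def map_comp_Some_iff ran_def)
  have val: "\<exists>y z. \<alpha> x = Some y \<and> \<beta> y = Some z \<and> pt_mult \<alpha> \<beta> x = Some z"
    if "x \<in> dom (pt_mult \<alpha> \<beta>)" for x
    using that by (auto simp: pt_mult_def map_comp_Some_iff)
  have dec: "z \<le> x" if "\<gamma> \<in> LS n" "\<gamma> x = Some z" for \<gamma> x z
    using that domI[of \<gamma> x z] by (auto simp: LS_def order_decreasing_def dest!: bspec[of _ _ x])
  have iso: "z \<le> z'" if "\<gamma> \<in> LS n" "\<gamma> x = Some z" "\<gamma> x' = Some z'" "x \<le> x'" for \<gamma> x x' z z'
    using that domI[of \<gamma> x z] domI[of \<gamma> x' z'] unfolding LS_def isotone_def
    by (metis (mono_tags, lifting) mem_Collect_eq option.sel)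
  have "isotone (pt_mult \<alpha> \<beta>)"
    unfolding isotone_def using val iso assms by (metis option.sel)
  moreover have "order_decreasing (pt_mult \<alpha> \<beta>)"
    unfolding order_decreasing_def using val dec assms by (metis option.sel order_trans)
  ultimately show ?thesis
    using sub assms by (auto simp: LS_def partial_transformations_def)
qed

lemma semigroup_LS: "semigroup_on (LS n) pt_mult"
  by (simp add: semigroup_on_def pt_mult_LS pt_mult_assoc)

lemma semigroup_SS': "semigroup_on (SS' n) pt_mult"
proof -
  have "1 \<notin> dom (pt_mult \<alpha> \<beta>)" if "1 \<notin> dom \<alpha>" for \<alpha> \<beta>
    using that by (auto simp: pt_mult_def map_comp_Some_iff)
  then show ?thesis
    by (simp add: semigroup_on_def SS'_def pt_mult_LS pt_mult_assoc)
qed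

end

(* Replacing every value of a by the least element of its fibre gives an idempotent e with
   the same domain and kernel as a.  In a product x a the map x acts first, so whether
   x a = y a depends only on the domain and kernel of a; hence a and e are R*-related. *)

theory Submission
  imports Defs
begin

text \<open>\<open>LEAST\<close> is only evaluated for a value \<open>v\<close> that is attained, at
  \<open>x\<close> itself, so the fibre is never empty and the well-order supplies a genuine
  minimum.\<close>

definition least_section :: "('a::wellorder \<rightharpoonup> 'b) \<Rightarrow> ('a \<rightharpoonup> 'a)" where
  "least_section \<alpha> x = map_option (\<lambda>v. LEAST y. \<alpha> y = Some v) (\<alpha> x)"

lemma least_section_Some_iff:
  "least_section \<alpha> x = Some y \<longleftrightarrow> (\<exists>v. \<alpha> x = Some v \<and> y = (LEAST y. \<alpha> y = Some v))"
  by (auto simp: least_section_def)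

lemma least_section_eq_None_iff: "least_section \<alpha> x = None \<longleftrightarrow> \<alpha> x = None"
  by (simp add: least_section_def)

lemma dom_least_section: "dom (least_section \<alpha>) = dom \<alpha>"
  by (auto simp: dom_def least_section_eq_None_iff)

lemma least_section_preimage: "least_section \<alpha> x = Some y \<Longrightarrow> \<alpha> y = \<alpha> x"
  using LeastI[of "\<lambda>z. \<alpha> z = \<alpha> x" x] by (auto simp: least_section_Some_iff)

lemma least_section_le: "least_section \<alpha> x = Some y \<Longrightarrow> y \<le> x"
  using Least_le[of "\<lambda>z. \<alpha> z = \<alpha> x" x] by (auto simp: least_section_Some_iff)

text \<open>The chosen point depends only on the fibre; conversely it lies in that fibre, so
  applying \<open>\<alpha>\<close> to it recovers \<open>\<alpha> x\<close>.\<close>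

lemma least_section_kernel: "least_section \<alpha> x = least_section \<alpha> y \<longleftrightarrow> \<alpha> x = \<alpha> y"
proof
  assume eq: "least_section \<alpha> x = least_section \<alpha> y"
  show "\<alpha> x = \<alpha> y"
  proof (cases "least_section \<alpha> x")
    case None
    then show ?thesis using eq by (metis least_section_eq_None_iff)
  next
    case (Some z)
    then show ?thesis using eq by (metis least_section_preimage)
  qed
qed (simp add: least_section_def)

lemma least_section_idem: "pt_mult (least_section \<alpha>) (least_section \<alpha>) = least_section \<alpha>"
proof
  fix x
  show "pt_mult (least_section \<alpha>) (least_section \<alpha>) x = least_section \<alpha> x"
  proof (cases "least_section \<alpha> x")
    case (Some y)
    \<comment> \<open>The representative \<open>y\<close> lies in the fibre of \<open>x\<close>, so
      both have the same representative.\<close>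
    have "least_section \<alpha> y = least_section \<alpha> x"
      by (simp only: least_section_kernel least_section_preimage[OF Some])
    with Some show ?thesis by (simp add: pt_mult_def)
  qed (simp add: pt_mult_def)
qed

text \<open>If the minima were reversed, \<open>q < p\<close>, then
  \<open>q < p \<le> x \<le> y\<close> with \<open>q\<close> in the fibre of \<open>y\<close>.
  Isotonicity squeezes \<open>x\<close> into that same fibre, which forces
  \<open>p = q\<close>.\<close>

lemma isotone_least_section:
  assumes "isotone \<alpha>"
  shows "isotone (least_section \<alpha>)"
  unfolding isotone_def
proof (intro ballI impI)
  fix x y
  assume "x \<in> dom (least_section \<alpha>)" "y \<in> dom (least_section \<alpha>)" and le: "x \<le> y"
  then obtain p q where p: "least_section \<alpha> x = Some p" and q: "least_section \<alpha> y = Some q"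
    by auto
  have "p \<le> q"
  proof (rule ccontr)
    assume "\<not> p \<le> q"
    then have "q \<le> x" using least_section_le[OF p] by simp
    have dom: "x \<in> dom \<alpha>" "y \<in> dom \<alpha>" "q \<in> dom \<alpha>" and q_eq: "\<alpha> q = \<alpha> y"
      using p q least_section_preimage[OF q] by (auto simp: least_section_Some_iff)
    have "the (\<alpha> q) \<le> the (\<alpha> x)" "the (\<alpha> x) \<le> the (\<alpha> y)"
      using assms dom \<open>q \<le> x\<close> le by (auto simp only: isotone_def)
    \<comment> \<open>The outer terms of the chain agree by \<open>q_eq\<close>; definedness lifts
      equality under \<open>the\<close> to equality of options.\<close>
    with q_eq dom have "\<alpha> x = \<alpha> y" by (auto simp: dom_def)
    then have "least_section \<alpha> x = least_section \<alpha> y" by (simp add: least_section_kernel)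
    with p q \<open>\<not> p \<le> q\<close> show False by simp
  qed
  with p q show "the (least_section \<alpha> x) \<le> the (least_section \<alpha> y)" by simp
qed

text \<open>Values of the section are points of \<open>dom \<alpha>\<close>, hence of
  \<open>{1..n}\<close>, and the domain is unchanged, so \<open>1\<close> stays outside it.\<close>

lemma least_section_SS':
  assumes "\<alpha> \<in> SS' n"
  shows "least_section \<alpha> \<in> SS' n"
proof -
  have "ran (least_section \<alpha>) \<subseteq> dom \<alpha>"
  proof
    fix y
    assume "y \<in> ran (least_section \<alpha>)"
    then obtain x where "least_section \<alpha> x = Some y" by (auto simp: ran_def)
    then show "y \<in> dom \<alpha>"
      using least_section_preimage[of \<alpha> x y] by (auto simp: least_section_Some_iff)
  qed
  moreover have "order_decreasing (least_section \<alpha>)"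
    by (auto simp: order_decreasing_def dest: least_section_le)
  ultimately show ?thesis
    using assms isotone_least_section[of \<alpha>]
    unfolding SS'_def LS_def partial_transformations_def mem_Collect_eq dom_least_section
    by blast
qed

lemma pt_mult_eq_iff_same_kernel:
  assumes "\<And>p. \<alpha> p = None \<longleftrightarrow> \<beta> p = None"
    and "\<And>p q. \<alpha> p = \<alpha> q \<longleftrightarrow> \<beta> p = \<beta> q"
  shows "pt_mult x \<alpha> = pt_mult y \<alpha> \<longleftrightarrow> pt_mult x \<beta> = pt_mult y \<beta>"
proof -
  \<comment> \<open>This orientation arises below when \<open>x t\<close> is undefined and
    \<open>y t = Some p\<close>.\<close>
  have "None = \<alpha> p \<longleftrightarrow> None = \<beta> p" for p
    using assms(1)[of p] by metis
  then have "(\<alpha> \<circ>\<^sub>m x) t = (\<alpha> \<circ>\<^sub>m y) t \<longleftrightarrow> (\<beta> \<circ>\<^sub>m x) t = (\<beta> \<circ>\<^sub>m y) t" for t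
    using assms by (cases "x t"; cases "y t") simp_all
  then show ?thesis by (simp add: pt_mult_def fun_eq_iff)
qed

(* The adjoined identity acts as the total identity map, which is Some. *)
lemma mul_one_pt_mult:
  "mul_one pt_mult x (Some \<alpha>) = Some (pt_mult (case x of None \<Rightarrow> Some | Some \<xi> \<Rightarrow> \<xi>) \<alpha>)"
  by (cases x) (simp_all add: pt_mult_def map_comp_def)

text \<open>The carrier is arbitrary: the kernel criterion holds for all partial maps as left
  factors, so it covers \<open>S\<close> and the total identity alike, whether or not an identity is
  adjoined.\<close>

lemma R_star_same_kernel:
  assumes "\<alpha> \<in> S" "\<beta> \<in> S"
    and "\<And>p. \<alpha> p = None \<longleftrightarrow> \<beta> p = None"
    and "\<And>p q. \<alpha> p = \<alpha> q \<longleftrightarrow> \<beta> p = \<beta> q"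
  shows "(\<alpha>, \<beta>) \<in> R_star S pt_mult"
  using assms(1,2) pt_mult_eq_iff_same_kernel[of \<alpha> \<beta>, OF assms(3,4)]
  by (simp add: R_star_def mul_one_pt_mult)

theorem theorem2p10:
  fixes n :: nat
  assumes "n \<ge> 2"
  shows "right_abundant (SS' n) pt_mult"
  unfolding right_abundant_def
proof
  fix C
  assume "C \<in> SS' n // R_star (SS' n) pt_mult"
  then obtain \<alpha> where \<alpha>: "\<alpha> \<in> SS' n" and C: "C = R_star (SS' n) pt_mult `` {\<alpha>}"
    by (rule quotientE)
  have "(\<alpha>, least_section \<alpha>) \<in> R_star (SS' n) pt_mult"
    using \<alpha> least_section_SS'[OF \<alpha>]
    by (rule R_star_same_kernel) (simp_all add: least_section_eq_None_iff least_section_kernel)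
  then show "\<exists>e\<in>C. pt_mult e e = e"
    using C least_section_idem by blast
qed

end
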